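(* Let $X\subseteq \mathbb{R}$. (a) If $X$ is a linearly bounded locally finite set, then it is strongly universal modulo similarities with respect to the sets with complement of finite measure. In particular, there is a constant $\varepsilon>0$ such that whenever $G\subseteq \mathbb{R}$ is a Lebesgue measurable set with $\lambda(G)<\varepsilon$, then the set $\{(a, b) \in \mathbb{R}\times [1, 2]: (a+bX) \subseteq (\mathbb{R} \setminus G)\}$ has infinite $2$-dimensional Lebesgue measure. (b) If $X$ is not a linearly bounded locally finite set, then it is not strongly universal modulo similarities with respect to the sets with complement of finite measure. Moreover, for every $\sigma$-finite Borel measure $\nu$ on $\mathbb{R}\times(\mathbb{R}\setminus\{0\})$ and for every $\varepsilon >0$ there exists an open set $G\subseteq \mathbb{R}$ with $\lambda (G)<\varepsilon$ such that $(a+bX)\cap G$ is infinite for $\nu$-almost every $(a, b)\in\mathbb{R}\times(\mathbb{R}\setminus\{0\})$.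
   Context: $\lambda$ and $\lambda^2$ denote (outer) Lebesgue measure on $\mathbb{R}$ and $\mathbb{R}^2$, respectively, $\mathbb{N}$ is the set of positive integers, and $a+bX=\{a+bx:x\in X\}$. A set $X \subseteq \mathbb{R}$ is called a linearly bounded locally finite set if $\sup\{n^{-1}\operatorname{card}(X\cap[-n, n]):n\in\mathbb{N}\}<\infty$. A set $X\subseteq\mathbb{R}$ is strongly universal modulo similarities with respect to the sets with complement of finite (Lebesgue) measure if $\lambda^2 \{(a, b) \in \mathbb{R}\times(\mathbb{R}\setminus\{0\}): (a+bX) \subseteq \mathbb{R} \setminus G\}>0$ for every Lebesgue measurable $G\subseteq\mathbb{R}$ with $\lambda(G)<\infty$. It is not strongly universal if and only if for every $\varepsilon>0$ there exists an open set $G\subseteq\mathbb{R}$ with $\lambda(G)<\varepsilon$ such that $\lambda^2 \{(a, b) \in \mathbb{R}\times(\mathbb{R}\setminus\{0\}): (a+bX) \subseteq \mathbb{R} \setminus G\}=0$. *)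

theory Defs
  imports "HOL-Analysis.Analysis"
begin

text \<open>Cardinalities are taken as counting measure, since \<^const>\<open>card\<close> of an infinite set is 0.\<close>

definition linearly_bounded_locally_finite :: "real set \<Rightarrow> bool" where
  "linearly_bounded_locally_finite X \<longleftrightarrow>
     (SUP n\<in>{1::nat..}. emeasure (count_space UNIV) (X \<inter> {- real n..real n}) / of_nat n) < \<infinity>"

text \<open>
  The set of parameters need not be Lebesgue measurable for arbitrary \<open>X\<close>; hence the outer measure.
\<close>

definition strongly_universal_mod_similarities :: "real set \<Rightarrow> bool" where
  "strongly_universal_mod_similarities X \<longleftrightarrow>
     (\<forall>G\<in>sets (lebesgue :: real measure). emeasure lebesgue G < \<infinity> \<longrightarrow>
        outer_measure_of (lebesgue :: (real \<times> real) measure)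
          {(a, b). b \<noteq> 0 \<and> (\<lambda>x. a + b * x) ` X \<subseteq> UNIV - G} > 0)"

end

(* (a) For fixed a and each nonzero x in X, the scales b in [r, 2r] with a + b x in G have measure
   at most the measure of those y in G with r|x| <= |y - a| <= 2r|x|, divided by |x|.  Summing over
   x, linear boundedness (applied on dyadic shells) bounds the total by K * measure G uniformly
   in a and r, so taking r > K * measure G leaves good scales of measure bounded away from 0 for
   every a outside G.

   (b) Cut a large interval into m cells of length h.  A parameter (a, b) in a bounded set moves N
   points of X into N different cells if h is small, so t greedily chosen cells are met by all
   parameters but a proportion (1 - N/m)^t <= exp (- t N / m).  With t h of order epsilon this is
   exp (- c epsilon N / n) when the N points lie in [-n, n], and N / n is unbounded exactly when X
   is not linearly bounded.  Using disjoint finite parts of X and Borel-Cantelli, almost every image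
   meets infinitely many of the sets obtained, in different points. *)
theory Submission imports Defs begin

section \<open>Linear boundedness in terms of cardinalities\<close>

text \<open>Infinite sets have counting measure \<open>\<infinity>\<close>, so a finite supremum
  forces finiteness of each intersection. The real form supplies one constant \<open>C\<close> for
  all radii; its negation supplies, for any \<open>C\<close>, a radius with infinitely many or more
  than \<open>C * n\<close> points.\<close>

lemma linearly_bounded_locally_finite_iff:
  "linearly_bounded_locally_finite X \<longleftrightarrow>
     (\<exists>C::real. \<forall>n\<ge>1. finite (X \<inter> {- real n..real n}) \<and>
        real (card (X \<inter> {- real n..real n})) \<le> C * real n)"
proof
  let ?E = "\<lambda>n. emeasure (count_space UNIV) (X \<inter> {- real n..real n})"
  assume "linearly_bounded_locally_finite X"
  then obtain c where c: "0 \<le> c" and sup: "(SUP n\<in>{1::nat..}. ?E n / of_nat n) = ennreal c"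
    unfolding linearly_bounded_locally_finite_def
    by (metis less_top_ennreal infinity_ennreal_def)
  show "\<exists>C::real. \<forall>n\<ge>1. finite (X \<inter> {- real n..real n}) \<and>
        real (card (X \<inter> {- real n..real n})) \<le> C * real n"
  proof (intro exI allI impI)
    fix n :: nat assume n: "1 \<le> n"
    have "?E n / of_nat n \<le> ennreal c"
      unfolding sup[symmetric] using n by (intro SUP_upper) auto
    then have "?E n / of_nat n * of_nat n \<le> ennreal c * of_nat n"
      by (rule mult_right_mono) auto
    moreover have "?E n / of_nat n * of_nat n = ?E n"
      using n by (simp add: ennreal_divide_times divide_ennreal ennreal_of_nat_eq_real_of_nat)
    ultimately have le: "?E n \<le> ennreal (c * real n)"
      using c by (simp add: ennreal_mult ennreal_of_nat_eq_real_of_nat)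
    then have fin: "finite (X \<inter> {- real n..real n})"
      by (metis emeasure_count_space_infinite ennreal_less_top infinity_ennreal_def
          linorder_not_less subset_UNIV)
    then show "finite (X \<inter> {- real n..real n}) \<and>
        real (card (X \<inter> {- real n..real n})) \<le> c * real n"
      using le c by (simp add: ennreal_of_nat_eq_real_of_nat)
  qed
next
  assume "\<exists>C::real. \<forall>n\<ge>1. finite (X \<inter> {- real n..real n}) \<and>
        real (card (X \<inter> {- real n..real n})) \<le> C * real n"
  then obtain C where C: "\<And>n. n \<ge> 1 \<Longrightarrow> finite (X \<inter> {- real n..real n})"
    "\<And>n. n \<ge> 1 \<Longrightarrow> real (card (X \<inter> {- real n..real n})) \<le> C * real n" by blast
  have "(SUP n\<in>{1::nat..}. emeasure (count_space UNIV) (X \<inter> {- real n..real n}) / of_nat n)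
        \<le> ennreal C"
  proof (rule SUP_least)
    fix n :: nat assume "n \<in> {1..}"
    then have n: "1 \<le> n" by simp
    have "ennreal (real (card (X \<inter> {- real n..real n}))) / ennreal (real n)
        = ennreal (real (card (X \<inter> {- real n..real n})) / real n)"
      using n by (intro divide_ennreal) auto
    also have "\<dots> \<le> ennreal C"
      using C(2)[OF n] n by (intro ennreal_leI) (simp add: divide_simps)
    finally show "emeasure (count_space UNIV) (X \<inter> {- real n..real n}) / of_nat n \<le> ennreal C"
      using C(1)[OF n] by (simp add: ennreal_of_nat_eq_real_of_nat)
  qed
  then show "linearly_bounded_locally_finite X"
    unfolding linearly_bounded_locally_finite_def
    by (metis ennreal_less_top infinity_ennreal_def order_le_less_trans)
qed

text \<open>Countability makes the parameter sets for open \<open>G\<close> Borel and allows Tonelli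
  against the counting measure on \<open>X\<close>.\<close>

lemma linearly_bounded_locally_finite_countable:
  assumes "linearly_bounded_locally_finite X"
  shows "countable X"
proof -
  \<comment> \<open>\<open>Suc n\<close> keeps the radius at least 1, as the characterisation
    requires.\<close>
  have eq: "X = (\<Union>n. X \<inter> {- real (Suc n)..real (Suc n)})"
  proof (intro equalityI subsetI)
    fix x assume "x \<in> X"
    moreover obtain n where "\<bar>x\<bar> \<le> real n" using real_arch_simple by blast
    ultimately show "x \<in> (\<Union>n. X \<inter> {- real (Suc n)..real (Suc n)})"
      by (intro UN_I[of n]) auto
  qed auto
  have "countable (X \<inter> {- real (Suc n)..real (Suc n)})" for n
    using assms unfolding linearly_bounded_locally_finite_iff
    by (metis countable_finite le_add1 plus_1_eq_Suc)
  then show ?thesis by (subst eq) (intro countable_UN countableI_type)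
qed

text \<open>For large \<open>t\<close> the sum has at most about \<open>C * \<bar>t\<bar>\<close>
  terms, each at most \<open>2 / \<bar>t\<bar>\<close>. With
  \<open>\<bar>t\<bar> = \<bar>y - a\<bar> / r\<close> it is the density with which a point
  \<open>y\<close> is hit by scales in \<open>[r, 2r]\<close>.\<close>

lemma linearly_bounded_locally_finite_dyadic_sum:
  assumes "linearly_bounded_locally_finite X"
  shows "\<exists>K>0. \<forall>t. finite {x \<in> X - {0}. \<bar>x\<bar> \<le> \<bar>t\<bar> \<and> \<bar>t\<bar> \<le> 2 * \<bar>x\<bar>} \<and>
           (\<Sum>x | x \<in> X - {0} \<and> \<bar>x\<bar> \<le> \<bar>t\<bar> \<and> \<bar>t\<bar> \<le> 2 * \<bar>x\<bar>. 1 / \<bar>x\<bar>) \<le> K"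
proof -
  obtain C where C: "\<And>n. n \<ge> 1 \<Longrightarrow> finite (X \<inter> {- real n..real n})"
    "\<And>n. n \<ge> 1 \<Longrightarrow> real (card (X \<inter> {- real n..real n})) \<le> C * real n"
    using assms unfolding linearly_bounded_locally_finite_iff by blast
  have C0: "0 \<le> C" using C(2)[of 1] by simp
  let ?F = "\<lambda>t. {x \<in> X - {0}. \<bar>x\<bar> \<le> \<bar>t\<bar> \<and> \<bar>t\<bar> \<le> 2 * \<bar>x\<bar>}"
  \<comment> \<open>This handles \<open>\<bar>t\<bar> < 1\<close>, where only points of
    \<open>[-1, 1]\<close> occur. A possible \<open>x = 0\<close> contributes
    \<open>1 / 0 = 0\<close>.\<close>
  define K0 where "K0 = (\<Sum>x\<in>X \<inter> {-1..1}. 1 / \<bar>x\<bar>)"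
  have fin1: "finite (X \<inter> {-1..1})" using C(1)[of 1] by simp
  have K0: "0 \<le> K0" unfolding K0_def by (intro sum_nonneg) auto
  have "finite (?F t) \<and> (\<Sum>x\<in>?F t. 1 / \<bar>x\<bar>) \<le> 4 * C + K0 + 1" for t
  proof (cases "\<bar>t\<bar> < 1")
    case True
    then have sub: "?F t \<subseteq> X \<inter> {-1..1}" by auto
    then have "(\<Sum>x\<in>?F t. 1 / \<bar>x\<bar>) \<le> K0"
      unfolding K0_def by (intro sum_mono2 fin1) auto
    then show ?thesis using finite_subset[OF sub fin1] C0 by simp
  next
    case False
    \<comment> \<open>Rounding up at most doubles \<open>\<bar>t\<bar>\<close>, because
      \<open>\<bar>t\<bar> \<ge> 1\<close> here.\<close>
    define n where "n = nat \<lceil>\<bar>t\<bar>\<rceil>"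
    have n: "1 \<le> n" "\<bar>t\<bar> \<le> real n" "real n \<le> 2 * \<bar>t\<bar>"
      using False unfolding n_def by linarith+
    have sub: "?F t \<subseteq> X \<inter> {- real n..real n}" using n by auto
    have fin: "finite (?F t)" using finite_subset[OF sub C(1)[OF n(1)]] .
    have "(\<Sum>x\<in>?F t. 1 / \<bar>x\<bar>) \<le> (\<Sum>x\<in>?F t. 2 / \<bar>t\<bar>)"
    proof (rule sum_mono)
      fix x assume "x \<in> ?F t"
      then show "1 / \<bar>x\<bar> \<le> 2 / \<bar>t\<bar>" using False by (auto simp: divide_simps)
    qed
    also have "\<dots> = real (card (?F t)) * (2 / \<bar>t\<bar>)" by simp
    also have "real (card (?F t)) \<le> real (card (X \<inter> {- real n..real n}))"
      using card_mono[OF C(1)[OF n(1)] sub] by simp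
    also have "\<dots> \<le> C * (2 * \<bar>t\<bar>)"
      using C(2)[OF n(1)] mult_left_mono[OF n(3) C0] by linarith
    finally have "(\<Sum>x\<in>?F t. 1 / \<bar>x\<bar>) \<le> C * (2 * \<bar>t\<bar>) * (2 / \<bar>t\<bar>)"
      by (simp add: divide_right_mono)
    also have "\<dots> = 4 * C" using False by simp
    finally show ?thesis using fin K0 by simp
  qed
  moreover have "4 * C + K0 + 1 > 0" using C0 K0 by linarith
  ultimately show ?thesis by blast
qed

section \<open>Similarities avoiding a set of small measure\<close>

text \<open>A union bound over \<open>x\<close>, the substitution \<open>y = a + b * x\<close> with
  Jacobian \<open>1 / \<bar>x\<bar>\<close>, and Tonelli reduce the estimate to the dyadic sum at
  each \<open>y\<close> in \<open>G\<close>. The bound is uniform in \<open>a\<close> and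
  \<open>r\<close>.\<close>

lemma bad_scales_measure_le:
  assumes X: "countable X"
    and K: "\<And>t. finite {x \<in> X - {0}. \<bar>x\<bar> \<le> \<bar>t\<bar> \<and> \<bar>t\<bar> \<le> 2 * \<bar>x\<bar>}"
      "\<And>t. (\<Sum>x | x \<in> X - {0} \<and> \<bar>x\<bar> \<le> \<bar>t\<bar> \<and> \<bar>t\<bar> \<le> 2 * \<bar>x\<bar>. 1 / \<bar>x\<bar>) \<le> K"
    and G[measurable]: "G \<in> sets (borel :: real measure)" and r: "r > 0"
  shows "emeasure lborel {b \<in> {r..2 * r}. \<exists>x\<in>X - {0}. a + b * x \<in> G} \<le> ennreal K * emeasure lborel G"
proof -
  have cX: "countable (X - {0})" using X by auto
  let ?B = "\<lambda>x. {b \<in> {r..2 * r}. a + b * x \<in> G}"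
  have [measurable]: "?B x \<in> sets borel" for x by measurable
  have UB: "{b \<in> {r..2 * r}. \<exists>x\<in>X - {0}. a + b * x \<in> G} = (\<Union>x\<in>X - {0}. ?B x)" by auto
  have mB: "(\<Union>x\<in>X - {0}. ?B x) \<in> sets borel"
    using cX by (intro sets.countable_UN') auto
  \<comment> \<open>The integrand after the substitution: \<open>b\<close> in \<open>[r, 2r]\<close>
    becomes a condition on \<open>\<bar>y - a\<bar>\<close> alone.\<close>
  let ?f = "\<lambda>x y. ennreal (1 / \<bar>x\<bar>) * (indicator {y. r * \<bar>x\<bar> \<le> \<bar>y - a\<bar> \<and> \<bar>y - a\<bar> \<le> 2 * r * \<bar>x\<bar>} y * indicator G y)"
  have "emeasure lborel (\<Union>x\<in>X - {0}. ?B x) = (\<integral>\<^sup>+b. indicator (\<Union>x\<in>X - {0}. ?B x) b \<partial>lborel)"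
    by (rule nn_integral_indicator[symmetric]) (use mB in \<open>simp only: sets_lborel\<close>)
  also have "\<dots> \<le> (\<integral>\<^sup>+b. \<integral>\<^sup>+x. indicator (?B x) b \<partial>count_space (X - {0}) \<partial>lborel)"
  proof (rule nn_integral_mono)
    fix b :: real
    show "indicator (\<Union>x\<in>X - {0}. ?B x) b \<le> (\<integral>\<^sup>+x. indicator (?B x) b \<partial>count_space (X - {0}))"
    proof (cases "b \<in> (\<Union>x\<in>X - {0}. ?B x)")
      case True
      then obtain x where x: "x \<in> X - {0}" "b \<in> ?B x" by blast
      have "indicator (\<Union>x\<in>X - {0}. ?B x) b = (1 :: ennreal)" "indicator (?B x) b = (1 :: ennreal)"
        using True x(2) by (simp_all only: indicator_simps)
      then show ?thesis using nn_integral_ge_point[OF x(1), of "\<lambda>x. indicator (?B x) b"] by (simp only:)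
    next
      case False
      then show ?thesis by (simp only: indicator_simps zero_le not_False_eq_True)
    qed
  qed
  also have "\<dots> = (\<integral>\<^sup>+x. \<integral>\<^sup>+b. indicator (?B x) b \<partial>lborel \<partial>count_space (X - {0}))"
    by (rule nn_integral_count_space_nn_integral[OF cX]) measurable
  also have "\<dots> \<le> (\<integral>\<^sup>+x. \<integral>\<^sup>+y. ?f x y \<partial>lborel \<partial>count_space (X - {0}))"
  proof (rule nn_integral_mono)
    fix x assume "x \<in> space (count_space (X - {0}))"
    then have x: "x \<noteq> 0" by simp
    \<comment> \<open>The affine change of variables, read backwards; the factors
      \<open>\<bar>x\<bar>\<close> and \<open>1 / \<bar>x\<bar>\<close> cancel.\<close>
    have "ennreal (1 / \<bar>x\<bar>) * (\<integral>\<^sup>+y. indicator (?B x) ((y - a) / x) \<partial>lborel)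
      = ennreal (1 / \<bar>x\<bar>) * (ennreal \<bar>x\<bar> * (\<integral>\<^sup>+b. indicator (?B x) ((a + x * b - a) / x) \<partial>lborel))"
      by (subst nn_integral_real_affine[OF _ x, of _ a]) auto
    also have "\<dots> = (\<integral>\<^sup>+b. indicator (?B x) b \<partial>lborel)"
      using x by (simp add: mult.assoc[symmetric] ennreal_mult[symmetric] del: nn_integral_indicator)
    finally have "(\<integral>\<^sup>+b. indicator (?B x) b \<partial>lborel)
        = ennreal (1 / \<bar>x\<bar>) * (\<integral>\<^sup>+y. indicator (?B x) ((y - a) / x) \<partial>lborel)" by simp
    also have "\<dots> = (\<integral>\<^sup>+y. ennreal (1 / \<bar>x\<bar>) * indicator (?B x) ((y - a) / x) \<partial>lborel)"
      by (intro nn_integral_cmult[symmetric]) measurable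
    also have "\<dots> \<le> (\<integral>\<^sup>+y. ?f x y \<partial>lborel)"
    proof (intro nn_integral_mono mult_left_mono)
      fix y :: real
      show "indicator (?B x) ((y - a) / x) \<le>
         (indicator {y. r * \<bar>x\<bar> \<le> \<bar>y - a\<bar> \<and> \<bar>y - a\<bar> \<le> 2 * r * \<bar>x\<bar>} y * indicator G y :: ennreal)"
      proof (cases "(y - a) / x \<in> ?B x")
        case True
        define b where "b = (y - a) / x"
        have y: "y - a = b * x" using x by (simp add: b_def)
        have b: "r \<le> b" "b \<le> 2 * r" "a + b * x \<in> G" using True by (auto simp: b_def)
        have "\<bar>y - a\<bar> = b * \<bar>x\<bar>" using y b r by (simp add: abs_mult)
        moreover have "y = a + b * x" using y by simp
        ultimately show ?thesis using b by (auto simp: indicator_def mult_right_mono)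
      qed simp
    qed simp
    finally show "(\<integral>\<^sup>+b. indicator (?B x) b \<partial>lborel) \<le> (\<integral>\<^sup>+y. ?f x y \<partial>lborel)" .
  qed
  also have "\<dots> = (\<integral>\<^sup>+y. \<integral>\<^sup>+x. ?f x y \<partial>count_space (X - {0}) \<partial>lborel)"
    by (rule nn_integral_count_space_nn_integral[OF cX, symmetric]) measurable
  also have "\<dots> \<le> (\<integral>\<^sup>+y. ennreal K * indicator G y \<partial>lborel)"
  proof (rule nn_integral_mono)
    fix y :: real
    \<comment> \<open>Dividing by \<open>r\<close> turns the shell condition into
      \<open>\<bar>x\<bar> \<le> \<bar>t\<bar> \<le> 2 * \<bar>x\<bar>\<close>, so \<open>K\<close>
      applies whatever \<open>a\<close> and \<open>r\<close> are.\<close>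
    define t where "t = (y - a) / r"
    let ?F = "{x \<in> X - {0}. \<bar>x\<bar> \<le> \<bar>t\<bar> \<and> \<bar>t\<bar> \<le> 2 * \<bar>x\<bar>}"
    have t: "\<bar>y - a\<bar> = r * \<bar>t\<bar>" using r by (simp add: t_def abs_mult)
    have "(\<integral>\<^sup>+x. ?f x y \<partial>count_space (X - {0})) = (\<Sum>x\<in>?F. ?f x y)"
      using r by (intro nn_integral_count_space' K(1)) (auto simp: t indicator_def)
    also have "\<dots> \<le> (\<Sum>x\<in>?F. ennreal (1 / \<bar>x\<bar>) * indicator G y)"
      by (intro sum_mono mult_left_mono) (auto simp: indicator_def)
    also have "\<dots> = ennreal (\<Sum>x\<in>?F. 1 / \<bar>x\<bar>) * indicator G y"
      by (simp add: sum_distrib_right[symmetric])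
    also have "\<dots> \<le> ennreal K * indicator G y"
      by (intro mult_right_mono ennreal_leI K(2)) simp
    finally show "(\<integral>\<^sup>+x. ?f x y \<partial>count_space (X - {0})) \<le> ennreal K * indicator G y" .
  qed
  also have "\<dots> = ennreal K * emeasure lborel G"
    by (simp add: nn_integral_cmult)
  finally show ?thesis unfolding UB .
qed

text \<open>For \<open>a\<close> outside an open superset of \<open>G\<close>, the bad scales leave
  at least a fixed length of \<open>[r, 2r]\<close>, and such \<open>a\<close> form a set of
  infinite measure. The radius \<open>r\<close> stays free: \<open>r = 1\<close> serves small
  \<open>G\<close>, a large \<open>r\<close> serves any \<open>G\<close> of finite measure.\<close>

lemma good_similarities_infinite_measure:
  assumes "linearly_bounded_locally_finite X"
  shows "\<exists>K>0. \<forall>G\<in>sets (lebesgue :: real measure). \<forall>r>0.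
     ennreal K * emeasure lebesgue G < ennreal r \<longrightarrow>
     outer_measure_of (lebesgue :: (real \<times> real) measure)
       {(a, b). b \<in> {r..2 * r} \<and> (\<lambda>x. a + b * x) ` X \<subseteq> UNIV - G} = \<infinity>"
proof -
  have X: "countable X" using assms by (rule linearly_bounded_locally_finite_countable)
  obtain K where K: "K > 0" "\<And>t. finite {x \<in> X - {0}. \<bar>x\<bar> \<le> \<bar>t\<bar> \<and> \<bar>t\<bar> \<le> 2 * \<bar>x\<bar>}"
      "\<And>t. (\<Sum>x | x \<in> X - {0} \<and> \<bar>x\<bar> \<le> \<bar>t\<bar> \<and> \<bar>t\<bar> \<le> 2 * \<bar>x\<bar>. 1 / \<bar>x\<bar>) \<le> K"
    using linearly_bounded_locally_finite_dyadic_sum[OF assms] by blast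
  have "outer_measure_of (lebesgue :: (real \<times> real) measure)
       {(a, b). b \<in> {r..2 * r} \<and> (\<lambda>x. a + b * x) ` X \<subseteq> UNIV - G} = \<infinity>"
    if G: "G \<in> sets (lebesgue :: real measure)" and r: "r > 0"
      and less: "ennreal K * emeasure lebesgue G < ennreal r" for G r
  proof -
    have "emeasure lebesgue G \<noteq> \<infinity>" using less K(1) by (auto simp: ennreal_mult_top)
    then obtain g where g: "g \<ge> 0" "emeasure lebesgue G = ennreal g"
      by (metis ennreal_cases infinity_ennreal_def)
    have Kg: "K * g < r" using less g K(1) r by (simp add: ennreal_mult[symmetric] ennreal_less_iff)
    \<comment> \<open>Half of the slack \<open>r - K * g\<close> is spent on enlarging
      \<open>G\<close> to an open set; the other half is the length \<open>d\<close> below.\<close>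
    define e where "e = (r - K * g) / (2 * K)"
    have e: "e > 0" using Kg K(1) by (simp add: e_def)
    obtain U where U: "open U" "G \<subseteq> U" "(U - G) \<in> lmeasurable" "emeasure lebesgue (U - G) < ennreal e"
      using sets_lebesgue_outer_open[OF G e] .
    have [measurable]: "U \<in> sets borel" using U(1) by simp
    have "emeasure lebesgue U = emeasure lebesgue (G \<union> (U - G))" using U(2) by (simp add: Un_absorb1)
    also have "\<dots> \<le> emeasure lebesgue G + emeasure lebesgue (U - G)"
      using G U by (intro emeasure_subadditive) (auto simp: fmeasurableD)
    also have "\<dots> \<le> ennreal g + ennreal e" using U(4) g by (intro add_mono) auto
    finally have mU: "emeasure lborel U \<le> ennreal (g + e)" using g e by simp
    define d where "d = (r - K * g) / 2"
    have d: "d > 0" "K * (g + e) = r - d"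
      using Kg K(1) by (auto simp: d_def e_def field_simps)
    \<comment> \<open>Using the open set \<open>U\<close> in place of \<open>G\<close> makes this
      set Borel, and it is contained in the set in question.\<close>
    define S where "S = {(a, b). b \<in> {r..2 * r} \<and> (\<lambda>x. a + b * x) ` X \<subseteq> UNIV - U}"
    have "S = {p \<in> space (borel \<Otimes>\<^sub>M borel). snd p \<in> {r..2 * r} \<and> (\<forall>x\<in>X. fst p + snd p * x \<in> UNIV - U)}"
      by (auto simp: S_def space_pair_measure)
    also have "\<dots> \<in> sets (borel \<Otimes>\<^sub>M borel)"
      using X by measurable
    finally have S[measurable]: "S \<in> sets (borel \<Otimes>\<^sub>M borel)" .
    \<comment> \<open>The bad scales ignore \<open>x = 0\<close>, whose image is \<open>a\<close>
      for every scale; the assumption \<open>a \<notin> U\<close> takes care of it.\<close>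
    have section_ge: "ennreal d \<le> emeasure lborel (Pair a -` S)" if a: "a \<notin> U" for a
    proof -
      let ?B = "{b \<in> {r..2 * r}. \<exists>x\<in>X - {0}. a + b * x \<in> U}"
      have mB: "?B \<in> sets borel"
      proof -
        have "?B = (\<Union>x\<in>X - {0}. {b \<in> {r..2 * r}. a + b * x \<in> U})" by auto
        also have "\<dots> \<in> sets borel" using X by (intro sets.countable_UN') auto
        finally show ?thesis .
      qed
      have mS: "Pair a -` S \<in> sets borel"
        using sets_Pair1[OF S] by simp
      have "{r..2 * r} \<subseteq> (Pair a -` S) \<union> ?B"
      proof
        fix b assume b: "b \<in> {r..2 * r}"
        show "b \<in> (Pair a -` S) \<union> ?B"
        proof (cases "\<exists>x\<in>X - {0}. a + b * x \<in> U")
          case False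
          have "a + b * x \<notin> U" if "x \<in> X" for x
            using that False a by (cases "x = 0") auto
          then show ?thesis using b by (auto simp: S_def)
        qed (use b in auto)
      qed
      then have "emeasure lborel {r..2 * r} \<le> emeasure lborel ((Pair a -` S) \<union> ?B)"
        by (rule emeasure_mono) (use mS mB in \<open>simp only: sets_lborel sets.Un\<close>)
      also have "\<dots> \<le> emeasure lborel (Pair a -` S) + emeasure lborel ?B"
        by (rule emeasure_subadditive) (use mS mB in \<open>simp_all only: sets_lborel\<close>)
      also have "emeasure lborel ?B \<le> ennreal K * emeasure lborel U"
        using K r by (intro bad_scales_measure_le[OF X]) auto
      also have "\<dots> \<le> ennreal K * ennreal (g + e)" using mU by (rule mult_left_mono) simp
      also have "\<dots> = ennreal (r - d)" using K(1) g e d by (simp only: ennreal_mult[symmetric] d(2)[symmetric])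
      finally have "ennreal r \<le> emeasure lborel (Pair a -` S) + ennreal (r - d)"
        using r by (simp add: add_left_mono)
      then have "ennreal r - ennreal (r - d) \<le> emeasure lborel (Pair a -` S)"
        by (simp add: ennreal_minus_le_iff add.commute)
      moreover have "0 \<le> r - d" using d(2) K(1) g e by (metis add_nonneg_nonneg less_imp_le mult_nonneg_nonneg)
      ultimately show ?thesis using d r by (simp add: ennreal_minus)
    qed
    have "emeasure lborel (UNIV - U) = \<infinity>"
    proof -
      have "emeasure lborel (UNIV :: real set) \<le> emeasure lborel U + emeasure lborel (UNIV - U)"
        using emeasure_subadditive[of U lborel "UNIV - U"] by simp
      then have "emeasure lborel U + emeasure lborel (UNIV - U) = top"
        by (simp add: top_unique)
      moreover have "emeasure lborel U \<noteq> top"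
        using mU by (metis ennreal_less_top linorder_not_less)
      ultimately show ?thesis by simp
    qed
    then have "top = ennreal d * emeasure lborel (UNIV - U)"
      using d by (simp add: ennreal_mult_top)
    also have "\<dots> = (\<integral>\<^sup>+a. ennreal d * indicator (UNIV - U) a \<partial>lborel)"
      by (simp add: nn_integral_cmult)
    also have "\<dots> \<le> (\<integral>\<^sup>+a. emeasure lborel (Pair a -` S) \<partial>lborel)"
      using section_ge by (intro nn_integral_mono) (auto simp: indicator_def)
    also have "\<dots> = emeasure (lborel \<Otimes>\<^sub>M lborel) S"
      by (rule lborel.emeasure_pair_measure_alt[symmetric]) simp
    also have "\<dots> = emeasure lborel S" by (simp only: lborel_prod)
    finally have "emeasure lborel S = \<infinity>" by (simp add: top_unique)
    moreover have "S \<in> sets borel" using S unfolding borel_prod .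
    ultimately have "outer_measure_of lebesgue S = \<infinity>" by simp
    moreover have "outer_measure_of lebesgue S \<le> outer_measure_of lebesgue
        {(a, b). b \<in> {r..2 * r} \<and> (\<lambda>x. a + b * x) ` X \<subseteq> UNIV - G}"
      using U(2) by (intro outer_measure_of_mono) (auto simp: S_def)
    ultimately show ?thesis by (simp add: top_unique)
  qed
  then show ?thesis using K(1) by blast
qed


section \<open>Greedy covering of affine images of a finite set\<close>

text \<open>Choosing at each step a set that meets the largest share of the points still uncovered.\<close>

lemma greedy_cover:
  fixes H :: "'i \<Rightarrow> 'a set"
  assumes C: "finite C" "C \<noteq> {}" and H: "\<And>c. c \<in> C \<Longrightarrow> H c \<in> sets M"
    and S: "S \<in> sets M" "emeasure M S < \<infinity>"
    and hits: "\<And>\<omega>. \<omega> \<in> S \<Longrightarrow> N \<le> card {c\<in>C. \<omega> \<in> H c}" and N: "N \<le> card C"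
  shows "\<exists>D\<subseteq>C. card D \<le> t \<and>
    measure M (S - (\<Union>c\<in>D. H c)) \<le> (1 - real N / real (card C)) ^ t * measure M S"
proof (induction t)
  case 0
  show ?case by (intro exI[of _ "{}"]) simp
next
  case (Suc t)
  then obtain D where D: "D \<subseteq> C" "card D \<le> t"
    and le: "measure M (S - (\<Union>c\<in>D. H c)) \<le> (1 - real N / real (card C)) ^ t * measure M S"
    by blast
  define R where "R = S - (\<Union>c\<in>D. H c)"
  have finD: "finite D" using finite_subset[OF D(1) C(1)] .
  have m: "card C > 0" using C by (simp add: card_gt_0_iff)
  have R[measurable]: "R \<in> sets M"
    unfolding R_def using S finD D(1) H by (intro sets.Diff sets.finite_UN) auto
  have finR: "emeasure M A < \<infinity>" if "A \<in> sets M" "A \<subseteq> R" for A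
    using emeasure_mono[of A S M] that S by (intro order_le_less_trans[OF _ S(2)]) (auto simp: R_def)
  have HR[measurable]: "R \<inter> H c \<in> sets M" if "c \<in> C" for c using H[OF that] by simp
  \<comment> \<open>Double counting: every point of the uncovered part \<open>R\<close> lies in at
    least \<open>N\<close> of the sets.\<close>
  have "of_nat N * emeasure M R = (\<integral>\<^sup>+\<omega>. of_nat N * indicator R \<omega> \<partial>M)"
    by (simp add: nn_integral_cmult)
  also have "\<dots> \<le> (\<integral>\<^sup>+\<omega>. (\<Sum>c\<in>C. indicator (R \<inter> H c) \<omega>) \<partial>M)"
  proof (rule nn_integral_mono)
    fix \<omega>
    show "of_nat N * indicator R \<omega> \<le> (\<Sum>c\<in>C. indicator (R \<inter> H c) \<omega> :: ennreal)"
    proof (cases "\<omega> \<in> R")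
      case True
      then have "(\<Sum>c\<in>C. indicator (R \<inter> H c) \<omega> :: ennreal) = (\<Sum>c\<in>C. of_bool (\<omega> \<in> H c))"
        by (intro sum.cong) (auto simp: indicator_def)
      also have "\<dots> = of_nat (card {c\<in>C. \<omega> \<in> H c})"
        using C(1) by (simp add: Int_def)
      finally show ?thesis using True hits[of \<omega>] by (simp add: R_def)
    qed simp
  qed
  also have "\<dots> = (\<Sum>c\<in>C. emeasure M (R \<inter> H c))"
    using HR by (subst nn_integral_sum) auto
  also have "\<dots> = ennreal (\<Sum>c\<in>C. measure M (R \<inter> H c))"
  proof -
    have "emeasure M (R \<inter> H c) = ennreal (measure M (R \<inter> H c))" if "c \<in> C" for c
      using finR[OF HR[OF that]] by (intro emeasure_eq_ennreal_measure) (simp add: less_top)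
    then show ?thesis by simp
  qed
  also have "of_nat N * emeasure M R = ennreal (real N * measure M R)"
    using finR[OF R] by (simp add: emeasure_eq_ennreal_measure less_top ennreal_mult ennreal_of_nat_eq_real_of_nat)
  finally have sum_ge: "real N * measure M R \<le> (\<Sum>c\<in>C. measure M (R \<inter> H c))"
    by (simp add: sum_nonneg)
  \<comment> \<open>Some set does at least as well as the average.\<close>
  have "\<exists>c\<in>C. real N / real (card C) * measure M R \<le> measure M (R \<inter> H c)"
  proof (rule ccontr)
    assume "\<not> ?thesis"
    then have "(\<Sum>c\<in>C. measure M (R \<inter> H c)) < (\<Sum>c\<in>C. real N / real (card C) * measure M R)"
      using C by (intro sum_strict_mono) auto
    also have "\<dots> = real N * measure M R" using m by simp
    finally show False using sum_ge by simp
  qed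
  then obtain c where c: "c \<in> C" "real N / real (card C) * measure M R \<le> measure M (R \<inter> H c)" by blast
  have eq: "S - (\<Union>c\<in>insert c D. H c) = R - R \<inter> H c" by (auto simp: R_def)
  have "measure M (R - R \<inter> H c) = measure M R - measure M (R \<inter> H c)"
    using c(1) HR R finR by (intro measure_Diff) (auto simp: less_top)
  also have "\<dots> \<le> (1 - real N / real (card C)) * measure M R"
    using c(2) by (simp add: algebra_simps)
  also have "\<dots> \<le> (1 - real N / real (card C)) * ((1 - real N / real (card C)) ^ t * measure M S)"
    using le N m by (intro mult_left_mono) (auto simp: R_def)
  finally have "measure M (S - (\<Union>c\<in>insert c D. H c)) \<le> (1 - real N / real (card C)) ^ Suc t * measure M S"
    unfolding eq by simp
  moreover have "card (insert c D) \<le> Suc t" using D(2) finD by (simp add: card_insert_if)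
  ultimately show ?case using c(1) D(1) by (intro exI[of _ "insert c D"]) auto
qed

text \<open>The gaps of \<open>Y\<close> only dictate how small the cell width \<open>h\<close> must
  be. Since the number of cells is of order \<open>B * n / h\<close> and the number of greedy
  choices is of order \<open>\<epsilon> / h\<close>, the width cancels and the exponent depends on
  \<open>Y\<close> only through \<open>card Y / n\<close>.\<close>

lemma cover_affine_images:
  fixes M :: "(real \<times> real) measure" and Y :: "real set"
  assumes f[measurable]: "fst \<in> borel_measurable M" "snd \<in> borel_measurable M"
    and S: "S \<in> sets M" "emeasure M S < \<infinity>"
    and B: "B \<ge> 1" "\<And>a b. (a, b) \<in> S \<Longrightarrow> \<bar>a\<bar> \<le> B \<and> 1 / B \<le> \<bar>b\<bar> \<and> \<bar>b\<bar> \<le> B"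
    and Y: "finite Y" "Y \<subseteq> {-n..n}" and n: "n \<ge> 1" and \<epsilon>: "\<epsilon> > 0"
  shows "\<exists>G. open G \<and> emeasure lborel G < ennreal \<epsilon> \<and>
    {p\<in>S. \<forall>y\<in>Y. fst p + snd p * y \<notin> G} \<in> sets M \<and>
    measure M {p\<in>S. \<forall>y\<in>Y. fst p + snd p * y \<notin> G} \<le> exp (- (\<epsilon> * card Y / (30 * B * n))) * measure M S"
proof -
  \<comment> \<open>A bound for \<open>\<bar>a + b * y\<bar>\<close>, from
    \<open>B + B * n \<le> 2 * B * n\<close>.\<close>
  define L where "L = 2 * B * n"
  have L: "L \<ge> 1" using B(1) n mult_mono[of 1 B 1 n] by (simp add: L_def)
  obtain g where g: "g > 0" "\<And>y z. y \<in> Y \<Longrightarrow> z \<in> Y \<Longrightarrow> y \<noteq> z \<Longrightarrow> g \<le> \<bar>y - z\<bar>"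
  proof -
    let ?P = "{p \<in> Y \<times> Y. fst p \<noteq> snd p}"
    \<comment> \<open>The extra element 1 keeps the minimum defined when \<open>Y\<close> has at
      most one point.\<close>
    let ?D = "insert 1 ((\<lambda>p. \<bar>fst p - snd p\<bar>) ` ?P)"
    have fin: "finite ?D" using Y(1) by auto
    then have "Min ?D \<in> ?D" by (intro Min_in) auto
    then have "Min ?D > 0" by auto
    moreover have "Min ?D \<le> \<bar>y - z\<bar>" if "y \<in> Y" "z \<in> Y" "y \<noteq> z" for y z
      using that fin by (intro Min_le) force+
    ultimately show thesis using that by blast
  qed
  obtain t :: nat where t: "t > 0" "\<epsilon> / 3 * B / g \<le> t" "\<epsilon> / 3 / L \<le> t"
  proof -
    obtain t :: nat where "max (\<epsilon> / 3 * B / g) (\<epsilon> / 3 / L) \<le> t" using real_arch_simple by blast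
    then show thesis by (intro that[of "Suc t"]) auto
  qed
  \<comment> \<open>The chosen cells will be replaced by intervals of length \<open>2 * h\<close>,
    so \<open>t\<close> of them have total length at most \<open>2 * \<epsilon> / 3\<close>. The
    lower bounds on \<open>t\<close> give \<open>h \<le> g / B\<close> and
    \<open>h \<le> L\<close>.\<close>
  define h where "h = \<epsilon> / (3 * t)"
  have h: "h > 0" "h \<le> g / B" "h \<le> L" "h * t = \<epsilon> / 3"
    using t \<epsilon> g(1) B(1) L by (auto simp: h_def field_simps)
  define q where "q = nat \<lceil>L / h\<rceil>"
  define C where "C = {- int q..int q}"
  \<comment> \<open>The parameters that send some point of \<open>Y\<close> into the cell with index
    \<open>c\<close>.\<close>
  define H where "H c = {p\<in>space M. \<exists>y\<in>Y. \<lfloor>(fst p + snd p * y) / h\<rfloor> = c}" for c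
  have finC: "finite C" and Cne: "C \<noteq> {}" by (auto simp: C_def)
  have q: "L / h \<le> q" "q \<le> 2 * L / h"
  proof -
    have "1 \<le> L / h" using h by simp
    then show "L / h \<le> q" "q \<le> 2 * L / h" unfolding q_def by linarith+
  qed
  have cardC: "card C = 2 * q + 1" by (simp add: C_def)
  have C_le: "card C \<le> 5 * L / h"
  proof -
    have "1 \<le> L / h" using h by simp
    then show ?thesis using q(2) unfolding cardC by simp
  qed
  have HM: "H c \<in> sets M" for c
  proof -
    have "H c = (\<Union>y\<in>Y. {p\<in>space M. \<lfloor>(fst p + snd p * y) / h\<rfloor> = c})" by (auto simp: H_def)
    also have "\<dots> \<in> sets M" using Y(1) by (intro sets.finite_UN) auto
    finally show ?thesis .
  qed
  have hits: "card Y \<le> card {c\<in>C. p \<in> H c}" if p: "p \<in> S" for p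
  proof -
    obtain a b where ab: "p = (a, b)" by (cases p)
    have bd: "\<bar>a\<bar> \<le> B" "1 / B \<le> \<bar>b\<bar>" "\<bar>b\<bar> \<le> B" using B(2) p ab by auto
    let ?i = "\<lambda>y. \<lfloor>(a + b * y) / h\<rfloor>"
    \<comment> \<open>Image points are at least \<open>g / B \<ge> h\<close> apart, hence lie in
      different half-open cells of length \<open>h\<close>.\<close>
    have inj: "inj_on ?i Y"
    proof (rule inj_onI, rule ccontr)
      fix y z assume yz: "y \<in> Y" "z \<in> Y" "?i y = ?i z" "y \<noteq> z"
      have "\<bar>(a + b * y) / h - (a + b * z) / h\<bar> < 1" using yz(3) by linarith
      moreover have "(a + b * y) / h - (a + b * z) / h = b * (y - z) / h"
        by (simp add: diff_divide_distrib[symmetric] algebra_simps)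
      ultimately have "\<bar>b\<bar> * \<bar>y - z\<bar> < h" using h(1) by (simp add: abs_mult divide_simps)
      moreover have "1 / B * g \<le> \<bar>b\<bar> * \<bar>y - z\<bar>"
        using g yz bd B(1) by (intro mult_mono) auto
      ultimately show False using h(2) by simp
    qed
    have "?i y \<in> C" if y: "y \<in> Y" for y
    proof -
      have "y \<in> {-n..n}" using Y(2) y by blast
      then have "\<bar>y\<bar> \<le> n" by (simp add: abs_le_iff)
      then have "\<bar>b * y\<bar> \<le> B * n" unfolding abs_mult using bd B(1) by (intro mult_mono) auto
      moreover have "B \<le> B * n" using B(1) n by simp
      ultimately have "\<bar>a + b * y\<bar> \<le> L" using bd(1) by (simp add: L_def)
      then have "\<bar>(a + b * y) / h\<bar> \<le> L / h" using h(1) by (simp add: divide_right_mono)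
      then have "- real q \<le> (a + b * y) / h" "(a + b * y) / h \<le> real q" using q(1) by linarith+
      then have "- int q \<le> ?i y" "?i y \<le> int q" by linarith+
      then show ?thesis unfolding C_def by simp
    qed
    then have "?i ` Y \<subseteq> {c\<in>C. p \<in> H c}"
      using p sets.sets_into_space[OF S(1)] by (auto simp: H_def ab)
    then have "card (?i ` Y) \<le> card {c\<in>C. p \<in> H c}" using finC by (intro card_mono) auto
    then show ?thesis by (simp add: card_image[OF inj])
  qed
  show ?thesis
  \<comment> \<open>The inequality \<open>card Y \<le> card C\<close> needed for the greedy choice
    is read off from a point of \<open>S\<close>.\<close>
  proof (cases "S = {}")
    case True
    then show ?thesis using \<epsilon> by (intro exI[of _ "{}"]) auto
  next
    case False
    then obtain p where "p \<in> S" by blast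
    then have "card Y \<le> card {c\<in>C. p \<in> H c}" by (rule hits)
    also have "\<dots> \<le> card C" using finC by (intro card_mono) auto
    finally have N: "card Y \<le> card C" .
    obtain D where D: "D \<subseteq> C" "card D \<le> t"
      "measure M (S - (\<Union>c\<in>D. H c)) \<le> (1 - real (card Y) / real (card C)) ^ t * measure M S"
      using greedy_cover[OF finC Cne HM S hits N] by blast
    have finD: "finite D" using finite_subset[OF D(1) finC] .
    \<comment> \<open>Each half-open cell is widened to the left by \<open>h\<close>, which makes it
      open.\<close>
    define G where "G = (\<Union>c\<in>D. {(real_of_int c - 1) * h<..<(real_of_int c + 1) * h})"
    have openG: "open G" unfolding G_def by auto
    then have [measurable]: "G \<in> sets borel" by simp
    have "emeasure lborel G \<le> (\<Sum>c\<in>D. emeasure lborel {(real_of_int c - 1) * h<..<(real_of_int c + 1) * h})"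
      unfolding G_def using finD by (intro emeasure_subadditive_finite) auto
    also have "\<dots> = (\<Sum>c\<in>D. ennreal (2 * h))"
      using h(1) by (intro sum.cong refl) (simp add: algebra_simps)
    also have "\<dots> = ennreal (card D * (2 * h))"
      using h(1) by (simp add: ennreal_mult ennreal_of_nat_eq_real_of_nat)
    also have "\<dots> < ennreal \<epsilon>"
    proof (rule ennreal_lessI[OF \<epsilon>])
      have "card D * (2 * h) \<le> t * (2 * h)" using D(2) h(1) by (intro mult_right_mono) auto
      also have "\<dots> = 2 * (h * t)" by simp
      also have "\<dots> < \<epsilon>" using h(4) \<epsilon> by simp
      finally show "card D * (2 * h) < \<epsilon>" .
    qed
    finally have mG: "emeasure lborel G < ennreal \<epsilon>" .
    let ?R = "{p\<in>S. \<forall>y\<in>Y. fst p + snd p * y \<notin> G}"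
    have "?R = S - (\<Union>y\<in>Y. {p\<in>space M. fst p + snd p * y \<in> G})"
      using sets.sets_into_space[OF S(1)] by auto
    also have "\<dots> \<in> sets M" using S(1) Y(1) by (intro sets.Diff sets.finite_UN) auto
    finally have RM: "?R \<in> sets M" .
    have sub: "?R \<subseteq> S - (\<Union>c\<in>D. H c)"
    proof (intro subsetI DiffI notI)
      fix p assume p: "p \<in> ?R" and "p \<in> (\<Union>c\<in>D. H c)"
      then obtain c y where c: "c \<in> D" "y \<in> Y" "\<lfloor>(fst p + snd p * y) / h\<rfloor> = c"
        by (auto simp: H_def)
      define u where "u = (fst p + snd p * y) / h"
      have "real_of_int c - 1 < u" "u < real_of_int c + 1" using c(3) unfolding u_def by linarith+
      then have "(real_of_int c - 1) * h < u * h" "u * h < (real_of_int c + 1) * h"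
        using h(1) by auto
      moreover have "u * h = fst p + snd p * y" using h(1) by (simp add: u_def)
      ultimately have "fst p + snd p * y \<in> G" using c(1) unfolding G_def by auto
      then show False using p c(2) by auto
    qed auto
    have RS: "S - (\<Union>c\<in>D. H c) \<in> sets M" using S(1) HM finD by (intro sets.Diff sets.finite_UN) auto
    have "emeasure M (S - (\<Union>c\<in>D. H c)) < \<infinity>"
      using emeasure_mono[OF Diff_subset S(1)] S(2) by (rule order_le_less_trans)
    then have "measure M ?R \<le> measure M (S - (\<Union>c\<in>D. H c))"
      using RM RS sub by (intro measure_mono_fmeasurable) (auto simp: fmeasurable_def)
    also have "\<dots> \<le> (1 - real (card Y) / real (card C)) ^ t * measure M S" by fact
    also have "\<dots> \<le> exp (- (\<epsilon> * card Y / (30 * B * n))) * measure M S"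
    proof (intro mult_right_mono)
      let ?x = "real (card Y) / real (card C)"
      have "0 \<le> 1 - ?x" using N cardC by (simp add: divide_simps)
      then have "(1 - ?x) ^ t \<le> exp (- ?x) ^ t"
        using exp_ge_add_one_self[of "- ?x"] by (intro power_mono) auto
      also have "\<dots> = exp (- (t * ?x))" by (simp add: exp_of_nat_mult[symmetric])
      also have "\<dots> \<le> exp (- (\<epsilon> * card Y / (30 * B * n)))"
      proof -
        \<comment> \<open>The constant is \<open>30 = 3 * 2 * 5\<close>, from
          \<open>h * t = \<epsilon> / 3\<close>, \<open>L = 2 * B * n\<close> and
          \<open>card C \<le> 5 * L / h\<close>.\<close>
        have "\<epsilon> * card Y / (30 * B * n) = (h * t) * card Y / (5 * L)"
          by (simp add: h(4) L_def)
        also have "\<dots> = t * (card Y / (5 * L / h))" using h(1) L by simp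
        also have "\<dots> \<le> t * ?x"
          using C_le cardC h(1) L by (intro mult_left_mono divide_left_mono mult_pos_pos divide_pos_pos) auto
        finally show ?thesis by simp
      qed
      finally show "(1 - ?x) ^ t \<le> exp (- (\<epsilon> * card Y / (30 * B * n)))" .
    qed simp
    finally show ?thesis using openG mG RM by blast
  qed
qed

section \<open>Small open sets meeting almost every image infinitely often\<close>

text \<open>Deleting finitely many points does not restore linear boundedness. This lets a later
  construction take its finite parts of \<open>X\<close> disjoint, with \<open>F\<close> holding the
  points already used.\<close>

lemma not_linearly_bounded_locally_finite_dense_subset:
  assumes X: "\<not> linearly_bounded_locally_finite X" and F: "finite F"
  shows "\<exists>n\<ge>1. \<exists>Y\<subseteq>X - F. finite Y \<and> Y \<subseteq> {- real n..real n} \<and> A * real n \<le> real (card Y)"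
proof -
  \<comment> \<open>The summand \<open>card F\<close> pays for the removal of \<open>F\<close>,
    since \<open>card F \<le> card F * n\<close>.\<close>
  define A' where "A' = nat \<lceil>A\<rceil> + card F"
  obtain n where n: "n \<ge> 1" "infinite (X \<inter> {- real n..real n}) \<or>
      A' * real n < real (card (X \<inter> {- real n..real n}))"
    using X unfolding linearly_bounded_locally_finite_iff by (metis not_le)
  obtain Z where Z: "Z \<subseteq> X \<inter> {- real n..real n}" "finite Z" "A' * real n \<le> card Z"
  proof (cases "infinite (X \<inter> {- real n..real n})")
    case True
    then obtain Z where "Z \<subseteq> X \<inter> {- real n..real n}" "finite Z" "card Z = A' * n"
      using infinite_arbitrarily_large by metis
    then show thesis using that by simp
  next
    case False
    then show thesis using n that[of "X \<inter> {- real n..real n}"] by auto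
  qed
  have "card Z - card F \<le> card (Z - F)" using F by (rule diff_card_le_card_Diff)
  then have "real (card Z) - card F \<le> card (Z - F)" by linarith
  moreover have "A * n + real (card F) * 1 \<le> A * n + real (card F) * real n"
    using n(1) by (intro add_left_mono mult_left_mono of_nat_0_le_iff) simp
  moreover have "A * n \<le> real (nat \<lceil>A\<rceil>) * n" by (intro mult_right_mono) linarith+
  moreover have "A' * real n = real (nat \<lceil>A\<rceil>) * n + real (card F) * real n" by (simp add: A'_def algebra_simps)
  ultimately have "A * n \<le> card (Z - F)" using Z(3) by linarith
  then show ?thesis using n(1) Z by (intro exI[of _ n] conjI exI[of _ "Z - F"]) auto
qed

lemma hit_bounded_parameters:
  fixes M :: "(real \<times> real) measure" and X :: "real set"
  assumes X: "\<not> linearly_bounded_locally_finite X" and F: "finite F"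
    and f: "fst \<in> borel_measurable M" "snd \<in> borel_measurable M"
    and S: "S \<in> sets M" "emeasure M S < \<infinity>"
    and B: "B \<ge> 1" "\<And>a b. (a, b) \<in> S \<Longrightarrow> \<bar>a\<bar> \<le> B \<and> 1 / B \<le> \<bar>b\<bar> \<and> \<bar>b\<bar> \<le> B"
    and \<epsilon>: "\<epsilon> > 0" and \<delta>: "\<delta> > 0"
  shows "\<exists>Y G. finite Y \<and> Y \<subseteq> X - F \<and> open G \<and> emeasure lborel G < ennreal \<epsilon> \<and>
    {p\<in>S. \<forall>y\<in>Y. fst p + snd p * y \<notin> G} \<in> sets M \<and>
    measure M {p\<in>S. \<forall>y\<in>Y. fst p + snd p * y \<notin> G} \<le> \<delta>"
proof -
  \<comment> \<open>Adding 1 keeps the logarithm meaningful when \<open>S\<close> is null.\<close>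
  define s where "s = measure M S + 1"
  have s: "s > 0" "measure M S \<le> s" by (auto simp: s_def add_nonneg_pos)
  \<comment> \<open>Chosen so that \<open>A * n\<close> points make the exponent equal to
    \<open>ln (s / \<delta>)\<close>.\<close>
  define A where "A = 30 * B / \<epsilon> * ln (s / \<delta>)"
  obtain n Y where n: "n \<ge> 1" and Y: "Y \<subseteq> X - F" "finite Y" "Y \<subseteq> {- real n..real n}"
      "A * real n \<le> real (card Y)"
    using not_linearly_bounded_locally_finite_dense_subset[OF X F, of A]
    by (elim exE conjE) (rule that)
  have n1: "real n \<ge> 1" using n by simp
  have "\<exists>G. open G \<and> emeasure lborel G < ennreal \<epsilon> \<and>
    {p\<in>S. \<forall>y\<in>Y. fst p + snd p * y \<notin> G} \<in> sets M \<and>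
    measure M {p\<in>S. \<forall>y\<in>Y. fst p + snd p * y \<notin> G} \<le> exp (- (\<epsilon> * card Y / (30 * B * n))) * measure M S"
    by (rule cover_affine_images[OF f S B Y(2,3) n1 \<epsilon>])
  then obtain G where G: "open G" "emeasure lborel G < ennreal \<epsilon>"
    "{p\<in>S. \<forall>y\<in>Y. fst p + snd p * y \<notin> G} \<in> sets M"
    "measure M {p\<in>S. \<forall>y\<in>Y. fst p + snd p * y \<notin> G} \<le> exp (- (\<epsilon> * card Y / (30 * B * n))) * measure M S"
    by (elim exE conjE) (rule that)
  have "ln (s / \<delta>) = \<epsilon> * (A * n) / (30 * B * n)"
    using B(1) n \<epsilon> by (simp add: A_def)
  also have "\<dots> \<le> \<epsilon> * card Y / (30 * B * n)"
    using Y(4) \<epsilon> B(1) by (intro divide_right_mono mult_left_mono) auto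
  finally have "exp (- (\<epsilon> * card Y / (30 * B * n))) \<le> exp (- ln (s / \<delta>))" by simp
  also have "\<dots> = \<delta> / s" using s \<delta> by (simp add: exp_minus)
  finally have "exp (- (\<epsilon> * card Y / (30 * B * n))) * measure M S \<le> \<delta> / s * s"
    using s \<delta> by (intro mult_mono) auto
  then show ?thesis using G Y(1,2) s by (intro exI[of _ Y] exI[of _ G]) auto
qed

text \<open>Stage \<open>k\<close> treats a bounded piece \<open>S k\<close> of the parameters with
  fresh points of \<open>X\<close> and misses at most \<open>(1 / 2) ^ k\<close> of its measure. By
  Borel-Cantelli almost every parameter is hit at all late stages, each time by a new point.\<close>

lemma almost_every_image_meets_infinitely:
  fixes M :: "(real \<times> real) measure" and X :: "real set"
  assumes X: "\<not> linearly_bounded_locally_finite X"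
    and setsM: "sets M = sets (restrict_space borel (UNIV \<times> (UNIV - {0})))"
    and M: "sigma_finite_measure M" and \<epsilon>: "\<epsilon> > 0"
  shows "\<exists>G :: real set. open G \<and> emeasure lebesgue G < ennreal \<epsilon> \<and>
           (AE (a, b) in M. infinite ((\<lambda>x. a + b * x) ` X \<inter> G))"
proof -
  interpret sigma_finite_measure M by fact
  have spM: "space M = UNIV \<times> (UNIV - {0})"
    using sets_eq_imp_space_eq[OF setsM] by (simp add: space_restrict_space)
  have f: "fst \<in> borel_measurable M" "snd \<in> borel_measurable M"
    unfolding measurable_cong_sets[OF setsM refl]
    by (intro measurable_restrict_space1 borel_measurable_continuous_onI
        continuous_on_fst[OF continuous_on_id] continuous_on_snd[OF continuous_on_id])+
  note [measurable] = f
  obtain E :: "nat \<Rightarrow> (real \<times> real) set" where E: "range E \<subseteq> sets M" "(\<Union>i. E i) = space M"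
    "\<And>i. emeasure M (E i) \<noteq> \<infinity>" "incseq E"
    using sigma_finite_incseq by blast
  define B where "B k = real k + 1" for k
  \<comment> \<open>These pieces have finite measure and satisfy the bounds of the covering lemma;
    since \<open>b\<close> is nonzero, every parameter lies in all but finitely many of
    them.\<close>
  define S where "S k = E k \<inter> {p\<in>space M. \<bar>fst p\<bar> \<le> B k \<and> 1 / B k \<le> \<bar>snd p\<bar> \<and> \<bar>snd p\<bar> \<le> B k}" for k
  have EM: "E k \<in> sets M" for k using E(1) by auto
  have SM: "S k \<in> sets M" for k unfolding S_def using EM by (intro sets.Int) auto
  have Sfin: "emeasure M (S k) < \<infinity>" for k
  proof -
    have "emeasure M (S k) \<le> emeasure M (E k)"
      unfolding S_def by (rule emeasure_mono[OF Int_lower1 EM])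
    also have "\<dots> < \<infinity>" using E(3)[of k] by (simp add: less_top)
    finally show ?thesis .
  qed
  have ev_S: "\<exists>k0. \<forall>k\<ge>k0. p \<in> S k" if p: "p \<in> space M" for p
  proof -
    obtain k1 where k1: "p \<in> E k1" using E(2) p by auto
    have b: "snd p \<noteq> 0" using p by (simp add: spM mem_Times_iff)
    obtain k2 :: nat where k2: "max (max \<bar>fst p\<bar> \<bar>snd p\<bar>) (1 / \<bar>snd p\<bar>) \<le> real k2"
      using real_arch_simple by blast
    have "p \<in> S k" if k: "k \<ge> max k1 k2" for k
    proof -
      have "p \<in> E k" using k1 E(4) k by (auto simp: incseq_def)
      moreover have B: "max (max \<bar>fst p\<bar> \<bar>snd p\<bar>) (1 / \<bar>snd p\<bar>) \<le> B k" using k2 k by (simp add: B_def)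
      moreover have "1 / B k \<le> \<bar>snd p\<bar>" using B b by (simp add: B_def field_simps)
      ultimately show ?thesis using p by (simp add: S_def)
    qed
    then show ?thesis by blast
  qed
  define bad where "bad k Y G = {p\<in>S k. \<forall>y\<in>Y. fst p + snd p * y \<notin> G}" for k Y G
  \<comment> \<open>A state is a triple: the points used earlier, the new points \<open>Y\<close>,
    and the open set \<open>G\<close> of this stage.\<close>
  define P where "P k W \<longleftrightarrow> (case W of (F, Y, G) \<Rightarrow> finite F \<and> finite Y \<and> Y \<subseteq> X - F \<and> open G \<and>
      emeasure lborel G < ennreal (\<epsilon> / 4 * (1 / 2) ^ k) \<and> bad k Y G \<in> sets M \<and>
      measure M (bad k Y G) \<le> (1 / 2) ^ k)" for k W
  have step: "\<exists>Y G. P k (F, Y, G)" if F: "finite F" for k F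
  proof -
    have Bk: "B k \<ge> 1" by (simp add: B_def)
    have bnd: "\<bar>a\<bar> \<le> B k \<and> 1 / B k \<le> \<bar>b\<bar> \<and> \<bar>b\<bar> \<le> B k" if "(a, b) \<in> S k" for a b
      using that by (simp add: S_def)
    have pos: "\<epsilon> / 4 * (1 / 2) ^ k > 0" "(1 / 2 :: real) ^ k > 0" using \<epsilon> by simp_all
    have "\<exists>Y G. finite Y \<and> Y \<subseteq> X - F \<and> open G \<and>
        emeasure lborel G < ennreal (\<epsilon> / 4 * (1 / 2) ^ k) \<and>
        {p\<in>S k. \<forall>y\<in>Y. fst p + snd p * y \<notin> G} \<in> sets M \<and>
        measure M {p\<in>S k. \<forall>y\<in>Y. fst p + snd p * y \<notin> G} \<le> (1 / 2) ^ k"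
      by (rule hit_bounded_parameters[OF X F f SM Sfin Bk bnd pos])
    then show ?thesis using F unfolding P_def bad_def by (simp only: prod.case simp_thms)
  qed
  \<comment> \<open>Dependent choice, because each stage must avoid the points picked before
    it.\<close>
  have "\<exists>W. \<forall>k. P k (W k) \<and> fst (W (Suc k)) = fst (W k) \<union> fst (snd (W k))"
  proof (rule dependent_nat_choice)
    show "\<exists>W. P 0 W" using step[of "{}" 0] by blast
    fix W k assume W: "P k W"
    then have "finite (fst W \<union> fst (snd W))" by (simp add: P_def case_prod_beta)
    then show "\<exists>W'. P (Suc k) W' \<and> fst W' = fst W \<union> fst (snd W)"
      using step[of _ "Suc k"] by (metis fst_conv)
  qed
  then obtain W where W: "\<And>k. P k (W k)" "\<And>k. fst (W (Suc k)) = fst (W k) \<union> fst (snd (W k))"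
    by (elim exE) metis
  define F where "F k = fst (W k)" for k
  define Y where "Y k = fst (snd (W k))" for k
  define G where "G k = snd (snd (W k))" for k
  have P: "Y k \<subseteq> X - F k" "open (G k)"
      "emeasure lborel (G k) < ennreal (\<epsilon> / 4 * (1 / 2) ^ k)" "bad k (Y k) (G k) \<in> sets M"
      "measure M (bad k (Y k) (G k)) \<le> (1 / 2) ^ k" for k
    using W(1)[of k] by (simp_all add: P_def F_def Y_def G_def case_prod_beta)
  have F_Suc: "F (Suc k) = F k \<union> Y k" for k using W(2) by (simp add: F_def Y_def)
  have incF: "F i \<subseteq> F j" if "i \<le> j" for i j
    using that by (rule lift_Suc_mono_le[of F, rotated]) (simp add: F_Suc)
  have disj: "Y i \<inter> Y j = {}" if "i < j" for i j
    using P(1)[of j] incF[of "Suc i" j] that by (auto simp: F_Suc)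
  let ?G = "\<Union>k. G k"
  have "emeasure lborel ?G \<le> (\<Sum>k. emeasure lborel (G k))"
    using P(2) by (intro emeasure_subadditive_countably) auto
  also have "\<dots> \<le> (\<Sum>k. ennreal (\<epsilon> / 4 * (1 / 2) ^ k))"
    using P(3) by (intro suminf_le) (auto simp: less_imp_le)
  also have "\<dots> = ennreal (\<epsilon> / 2)"
  proof -
    \<comment> \<open>The budgets add up to \<open>\<epsilon> / 2\<close>, which leaves room for the
      strict inequality.\<close>
    have "(\<lambda>k. \<epsilon> / 4 * (1 / 2) ^ k) sums (\<epsilon> / 4 * 2)"
      using geometric_sums[of "1 / 2 :: real"] by (intro sums_mult) simp
    then show ?thesis using \<epsilon> by (subst suminf_ennreal_eq[where x = "\<epsilon> / 2"]) auto
  qed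
  also have "\<dots> < ennreal \<epsilon>" using \<epsilon> by (intro ennreal_lessI) auto
  finally have mG: "emeasure lebesgue ?G < ennreal \<epsilon>" using P(2) by simp
  have "AE p in M. \<forall>\<^sub>F k in sequentially. p \<in> space M - bad k (Y k) (G k)"
  proof (rule borel_cantelli_AE1)
    show "summable (\<lambda>k. measure M (bad k (Y k) (G k)))"
      by (rule summable_comparison_test'[of "\<lambda>k. (1 / 2) ^ k" 0]) (use P(5) in auto)
    show "emeasure M (bad k (Y k) (G k)) < \<infinity>" for k
      using SM by (intro order_le_less_trans[OF emeasure_mono Sfin[of k]]) (auto simp: bad_def)
  qed (rule P(4))
  then have "AE p in M. infinite ((\<lambda>x. fst p + snd p * x) ` X \<inter> ?G)"
  proof (eventually_elim)
    case (elim p)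
    then obtain k1 where k1: "\<And>k. k \<ge> k1 \<Longrightarrow> p \<in> space M - bad k (Y k) (G k)"
      by (auto simp: eventually_sequentially)
    then have p: "p \<in> space M" by auto
    then obtain k2 where k2: "\<And>k. k \<ge> k2 \<Longrightarrow> p \<in> S k" using ev_S[OF p] by blast
    define k0 where "k0 = max k1 k2"
    have b: "snd p \<noteq> 0" using p by (simp add: spM mem_Times_iff)
    have "\<exists>y. y \<in> Y (k0 + k) \<and> fst p + snd p * y \<in> G (k0 + k)" for k
    proof -
      have "k1 \<le> k0 + k" "k2 \<le> k0 + k" by (auto simp: k0_def)
      then have "p \<in> S (k0 + k)" "p \<notin> bad (k0 + k) (Y (k0 + k)) (G (k0 + k))"
        using k1 k2 by blast+
      then show ?thesis unfolding bad_def by blast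
    qed
    then obtain y where y: "\<And>k. y k \<in> Y (k0 + k)" "\<And>k. fst p + snd p * y k \<in> G (k0 + k)" by metis
    \<comment> \<open>Different stages use disjoint sets \<open>Y\<close>, and
      \<open>b \<noteq> 0\<close> keeps the images of their points distinct.\<close>
    have "inj (\<lambda>k. fst p + snd p * y k)"
    proof (rule linorder_injI)
      fix i j :: nat assume "i < j"
      then have "y i \<noteq> y j" using disj[of "k0 + i" "k0 + j"] y(1)[of i] y(1)[of j] by auto
      then show "fst p + snd p * y i \<noteq> fst p + snd p * y j" using b by simp
    qed
    then have "infinite (range (\<lambda>k. fst p + snd p * y k))" by (rule range_inj_infinite)
    moreover have "range (\<lambda>k. fst p + snd p * y k) \<subseteq> (\<lambda>x. fst p + snd p * x) ` X \<inter> ?G"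
      using y P(1) by blast
    ultimately show ?case by (rule infinite_super[rotated])
  qed
  moreover have "open ?G" using P(2) by blast
  ultimately show ?thesis using mG unfolding case_prod_beta by blast
qed

section \<open>The dichotomy\<close>

theorem theorem7:
  fixes X :: "real set"
  shows "(linearly_bounded_locally_finite X \<longrightarrow>
            strongly_universal_mod_similarities X \<and>
            (\<exists>\<epsilon>::real. \<epsilon> > 0 \<and>
               (\<forall>G\<in>sets (lebesgue :: real measure). emeasure lebesgue G < ennreal \<epsilon> \<longrightarrow>
                  outer_measure_of (lebesgue :: (real \<times> real) measure)
                    {(a, b). b \<in> {1..2} \<and> (\<lambda>x. a + b * x) ` X \<subseteq> UNIV - G} = \<infinity>)))
       \<and> (\<not> linearly_bounded_locally_finite X \<longrightarrow>
            \<not> strongly_universal_mod_similarities X \<and>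
            (\<forall>(\<nu> :: (real \<times> real) measure) (\<epsilon>::real).
               sets \<nu> = sets (restrict_space borel (UNIV \<times> (UNIV - {0}))) \<and>
               sigma_finite_measure \<nu> \<and> \<epsilon> > 0 \<longrightarrow>
               (\<exists>G :: real set. open G \<and> emeasure lebesgue G < ennreal \<epsilon> \<and>
                  (AE (a, b) in \<nu>. infinite ((\<lambda>x. a + b * x) ` X \<inter> G)))))"
proof (intro conjI impI)
  assume "linearly_bounded_locally_finite X"
  then obtain K where K: "K > 0" "\<And>G r. G \<in> sets (lebesgue :: real measure) \<Longrightarrow> r > 0 \<Longrightarrow>
      ennreal K * emeasure lebesgue G < ennreal r \<Longrightarrow>
      outer_measure_of (lebesgue :: (real \<times> real) measure)
       {(a, b). b \<in> {r..2 * r} \<and> (\<lambda>x. a + b * x) ` X \<subseteq> UNIV - G} = \<infinity>"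
    using good_similarities_infinite_measure by blast
  show "strongly_universal_mod_similarities X"
    unfolding strongly_universal_mod_similarities_def
  proof (intro ballI impI)
    fix G :: "real set" assume G: "G \<in> sets lebesgue" "emeasure lebesgue G < \<infinity>"
    then obtain g where g: "g \<ge> 0" "emeasure lebesgue G = ennreal g"
      by (metis less_top_ennreal infinity_ennreal_def)
    \<comment> \<open>Large scales compensate for a large \<open>G\<close>: any \<open>r\<close>
      above \<open>K * g\<close> works.\<close>
    define r where "r = K * g + 1"
    have r: "r > 0" using K(1) g by (simp add: r_def add_nonneg_pos)
    have "ennreal K * emeasure lebesgue G < ennreal r"
      using K(1) g by (simp add: r_def ennreal_mult[symmetric] ennreal_lessI add_nonneg_pos)
    then have "outer_measure_of (lebesgue :: (real \<times> real) measure)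
       {(a, b). b \<in> {r..2 * r} \<and> (\<lambda>x. a + b * x) ` X \<subseteq> UNIV - G} = \<infinity>"
      by (rule K(2)[OF G(1) r])
    moreover have "{(a, b). b \<in> {r..2 * r} \<and> (\<lambda>x. a + b * x) ` X \<subseteq> UNIV - G}
       \<subseteq> {(a, b). b \<noteq> 0 \<and> (\<lambda>x. a + b * x) ` X \<subseteq> UNIV - G}" using r by auto
    ultimately show "outer_measure_of (lebesgue :: (real \<times> real) measure)
        {(a, b). b \<noteq> 0 \<and> (\<lambda>x. a + b * x) ` X \<subseteq> UNIV - G} > 0"
      using outer_measure_of_mono[of "{(a, b). b \<in> {r..2 * r} \<and> (\<lambda>x. a + b * x) ` X \<subseteq> UNIV - G}"
          "{(a, b). b \<noteq> 0 \<and> (\<lambda>x. a + b * x) ` X \<subseteq> UNIV - G}" lebesgue]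
      by (simp add: top_unique)
  qed
  show "\<exists>\<epsilon>::real. \<epsilon> > 0 \<and>
       (\<forall>G\<in>sets (lebesgue :: real measure). emeasure lebesgue G < ennreal \<epsilon> \<longrightarrow>
          outer_measure_of (lebesgue :: (real \<times> real) measure)
            {(a, b). b \<in> {1..2} \<and> (\<lambda>x. a + b * x) ` X \<subseteq> UNIV - G} = \<infinity>)"
  \<comment> \<open>With \<open>\<epsilon> = 1 / K\<close> the scale \<open>r = 1\<close> is
    admissible, which gives the interval \<open>[1, 2]\<close>.\<close>
  proof (intro exI[of _ "1 / K"] conjI ballI impI)
    fix G :: "real set" assume G: "G \<in> sets lebesgue" "emeasure lebesgue G < ennreal (1 / K)"
    have "ennreal K * emeasure lebesgue G < ennreal K * ennreal (1 / K)"
      using G(2) K(1) by (intro ennreal_mult_strict_left_mono) auto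
    also have "\<dots> = ennreal 1" using K(1) by (subst ennreal_mult[symmetric]) auto
    finally show "outer_measure_of (lebesgue :: (real \<times> real) measure)
            {(a, b). b \<in> {1..2} \<and> (\<lambda>x. a + b * x) ` X \<subseteq> UNIV - G} = \<infinity>"
      using K(2)[OF G(1), of 1] by simp
  qed (use K(1) in simp)
next
  assume X: "\<not> linearly_bounded_locally_finite X"
  show "\<not> strongly_universal_mod_similarities X"
  proof
    assume univ: "strongly_universal_mod_similarities X"
    let ?\<Omega> = "UNIV \<times> (UNIV - {0}) :: (real \<times> real) set"
    \<comment> \<open>Planar Lebesgue measure is itself an admissible \<open>\<nu>\<close>; the
      bound 1 for \<open>G\<close> only serves to make its measure finite.\<close>
    let ?\<nu> = "restrict_space (lborel :: (real \<times> real) measure) ?\<Omega>"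
    have \<Omega>: "?\<Omega> \<in> sets borel" by (intro borel_open open_Times) auto
    have "sets ?\<nu> = sets (restrict_space borel ?\<Omega>)" by (intro sets_restrict_space_cong) simp
    moreover have "sigma_finite_measure ?\<nu>"
      using \<Omega> by (intro sigma_finite_measure_restrict_space lborel.sigma_finite_measure_axioms) simp
    ultimately obtain G :: "real set" where G: "open G" "emeasure lebesgue G < ennreal 1"
      "AE (a, b) in ?\<nu>. infinite ((\<lambda>x. a + b * x) ` X \<inter> G)"
      using almost_every_image_meets_infinitely[OF X, of ?\<nu> 1] by auto
    let ?Z = "{(a, b). b \<noteq> 0 \<and> (\<lambda>x. a + b * x) ` X \<subseteq> UNIV - G}"
    have "AE p in lborel. p \<in> ?\<Omega> \<longrightarrow> infinite ((\<lambda>x. fst p + snd p * x) ` X \<inter> G)"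
      using G(3) \<Omega> by (subst (asm) AE_restrict_space_iff) (auto simp: case_prod_beta)
    then have "AE p in lborel. p \<notin> ?Z"
    proof eventually_elim
      case (elim p)
      show ?case
      proof
        assume p: "p \<in> ?Z"
        then have "(\<lambda>x. fst p + snd p * x) ` X \<inter> G = {}" "p \<in> ?\<Omega>" by (auto simp: case_prod_beta mem_Times_iff)
        then show False using elim by simp
      qed
    qed
    then obtain N where N: "?Z \<subseteq> N" "N \<in> sets lborel" "emeasure lborel N = 0"
      by (auto elim!: AE_E)
    \<comment> \<open>\<open>?Z\<close> may fail to be Borel, so its outer measure is bounded by
      that of a Borel null set containing it.\<close>
    have "outer_measure_of lebesgue ?Z \<le> outer_measure_of lebesgue N"
      by (rule outer_measure_of_mono[OF N(1)])
    also have "\<dots> = 0" using N(2,3) by simp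
    finally have "outer_measure_of lebesgue ?Z = 0" by simp
    moreover have "emeasure lebesgue G < \<infinity>"
      using G(2) by (metis ennreal_less_top infinity_ennreal_def order.strict_trans)
    ultimately show False
      using univ G(1) unfolding strongly_universal_mod_similarities_def by (auto dest!: bspec[of _ _ G])
  qed
  show "\<forall>(\<nu> :: (real \<times> real) measure) (\<epsilon>::real).
       sets \<nu> = sets (restrict_space borel (UNIV \<times> (UNIV - {0}))) \<and>
       sigma_finite_measure \<nu> \<and> \<epsilon> > 0 \<longrightarrow>
       (\<exists>G :: real set. open G \<and> emeasure lebesgue G < ennreal \<epsilon> \<and>
          (AE (a, b) in \<nu>. infinite ((\<lambda>x. a + b * x) ` X \<inter> G)))"
    using almost_every_image_meets_infinitely[OF X] by blast
qed

end
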